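(* Let $d\ge 1$, let $G=\operatorname{GEV}(\mu,\gamma,\alpha,\ell)$ be a $d$-variate generalized extreme-value distribution with $\mu,\gamma\in\mathbb R^d$, $\alpha\in(0,\infty)^d$ and $\ell$ a $d$-variate stable tail dependence function, and suppose that $\sigma=\alpha-\gamma\mu$ (componentwise) belongs to $(0,\infty)^d$. Let $H=\operatorname{GP}(G)$ be the associated generalized Pareto distribution. Then for every $x\in\mathbb R^d$ such that $\sigma_j+\gamma_jx_j>0$ for all $j=1,\dots,d$, we have $$H(x)=\ell\Bigl\{\pi\,\bigl(1+\gamma\tfrac{x\wedge 0}{\sigma}\bigr)^{-1/\gamma}\Bigr\}-\ell\Bigl\{\pi\,\bigl(1+\gamma\tfrac{x}{\sigma}\bigr)^{-1/\gamma}\Bigr\},$$ (all operations on vectors componentwise), where, for $j=1,\dots,d$, $$\pi_j=\tau_j/\ell(\tau)\in(0,1],\qquad \tau_j=-\log G_j(0)=(1-\gamma_j\mu_j/\alpha_j)^{-1/\gamma_j}\in(0,\infty),\qquad \ell(\tau)=-\log G(0,\dots,0).$$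
   Context: Conventions: $(1+\gamma x)^{-1/\gamma}$ is read as $e^{-x}$ if $\gamma=0$. Operations and order relations between vectors are componentwise; $a\wedge b=\min(a,b)$. A function $\ell:[0,\infty)^d\to[0,\infty)$ is a stable tail dependence function (stdf) if there is a random vector $V$ with values in $[0,\infty)^d$ and $\mathbb E[V_j]=1$ for all $j$ such that $\ell(y)=\mathbb E[\max_{j}(y_jV_j)]$ for all $y\in[0,\infty)^d$. $G=\operatorname{GEV}(\mu,\gamma,\alpha,\ell)$ denotes the cdf on $\mathbb R^d$ with margins $G_j(x_j)=\exp[-\{1+\gamma_j(x_j-\mu_j)/\alpha_j\}^{-1/\gamma_j}]$ for $x_j$ with $\alpha_j+\gamma_j(x_j-\mu_j)>0$ (read as $\exp[-\exp\{-(x_j-\mu_j)/\alpha_j\}]$ if $\gamma_j=0$; otherwise $G_j$ equals $0$ below its lower endpoint and $1$ above its upper endpoint), and with $G(x)=\exp[-\ell\{-\log G_1(x_1),\dots,-\log G_d(x_d)\}]$ whenever $G_j(x_j)>0$ for all $j$. Let $\eta_j\in[-\infty,0)$ be the lower endpoint of $G_j$ (the condition $0<G_j(0)<1$ is equivalent to $\sigma_j>0$). $H=\operatorname{GP}(G)$ is the probability distribution concentrated on $\{x\in[-\infty,\infty)^d: x\ge\eta,\ x_j>0\text{ for some }j\}$ whose cdf (also denoted $H$) is $$H(x)=\frac{\log G(x\wedge 0)-\log G(x)}{\log G(0)},\qquad x\in\mathbb R^d,\ x_j>\eta_j\ \text{for all } j.$$ *)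

theory Defs
  imports "HOL-Probability.Probability"
begin

text \<open>\<open>gp_pow \<gamma> z\<close> is $(1 + \gamma z)^{-1/\gamma}$, read as $e^{-z}$ if $\gamma = 0$.  It is
  meaningful for \<open>1 + \<gamma> * z > 0\<close>, the only case in which it is used.\<close>

definition gp_pow :: "real \<Rightarrow> real \<Rightarrow> real" where
  "gp_pow \<gamma> z = (if \<gamma> = 0 then exp (- z) else (1 + \<gamma> * z) powr (- 1 / \<gamma>))"

text \<open>The measure \<open>M\<close> is the law of the random vector \<open>V\<close>.  A stable tail dependence function
  lives on $[0,\infty)^d$; values of \<open>l\<close> outside this orthant are irrelevant.\<close>

definition stdf :: "(real ^ 'd \<Rightarrow> real) \<Rightarrow> bool" where
  "stdf l \<longleftrightarrow>
    (\<exists>M :: (real ^ 'd) measure.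
      prob_space M \<and> sets M = sets borel \<and>
      (AE v in M. \<forall>j. 0 \<le> v $ j) \<and>
      (\<forall>j. integrable M (\<lambda>v. v $ j) \<and> (\<integral>v. v $ j \<partial>M) = 1) \<and>
      (\<forall>y. (\<forall>j. 0 \<le> y $ j) \<longrightarrow> l y = (\<integral>v. (MAX j. y $ j * v $ j) \<partial>M)))"

text \<open>The order on vectors is componentwise, so that \<open>{..x}\<close> is the lower orthant of \<open>x\<close>.\<close>

definition joint_cdf :: "('a::{ord, topological_space} ^ 'd) measure \<Rightarrow> 'a ^ 'd \<Rightarrow> real" where
  "joint_cdf M x = measure M {..x}"

definition margin_cdf :: "(real ^ 'd) measure \<Rightarrow> 'd \<Rightarrow> real \<Rightarrow> real" where
  "margin_cdf M j = cdf (distr M borel (\<lambda>y. y $ j))"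

text \<open>If \<open>\<alpha> + \<gamma> * (t - \<mu>) \<le> 0\<close>, then \<open>t\<close> lies at or below the lower endpoint (\<open>\<gamma> > 0\<close>) or at or
  above the upper endpoint (\<open>\<gamma> < 0\<close>).\<close>

definition gev_margin :: "real \<Rightarrow> real \<Rightarrow> real \<Rightarrow> real \<Rightarrow> real" where
  "gev_margin \<mu> \<gamma> \<alpha> t =
    (if \<alpha> + \<gamma> * (t - \<mu>) > 0 then exp (- gp_pow \<gamma> ((t - \<mu>) / \<alpha>))
     else if \<gamma> > 0 then 0 else 1)"

definition is_GEV ::
  "real ^ 'd \<Rightarrow> real ^ 'd \<Rightarrow> real ^ 'd \<Rightarrow> (real ^ 'd \<Rightarrow> real) \<Rightarrow> (real ^ 'd) measure \<Rightarrow> bool" where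
  "is_GEV \<mu> \<gamma> \<alpha> l G \<longleftrightarrow>
    prob_space G \<and> sets G = sets borel \<and>
    (\<forall>j t. margin_cdf G j t = gev_margin (\<mu> $ j) (\<gamma> $ j) (\<alpha> $ j) t) \<and>
    (\<forall>x. (\<forall>j. 0 < margin_cdf G j (x $ j)) \<longrightarrow>
      joint_cdf G x = exp (- l (\<chi> j. - ln (margin_cdf G j (x $ j)))))"

definition lower_endpoint :: "(real ^ 'd) measure \<Rightarrow> 'd \<Rightarrow> ereal" where
  "lower_endpoint G j = Inf {ereal t | t. 0 < margin_cdf G j t}"

text \<open>A generalized Pareto distribution may charge points with components \<open>-\<infinity>\<close>, hence it is a
  measure on vectors of extended reals.\<close>

definition is_GP :: "(real ^ 'd) measure \<Rightarrow> (ereal ^ 'd) measure \<Rightarrow> bool" where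
  "is_GP G H \<longleftrightarrow>
    prob_space H \<and> sets H = sets borel \<and>
    (AE y in H. (\<forall>j. lower_endpoint G j \<le> y $ j \<and> y $ j < \<infinity>) \<and> (\<exists>j. 0 < y $ j)) \<and>
    (\<forall>x :: real ^ 'd. (\<forall>j. lower_endpoint G j < ereal (x $ j)) \<longrightarrow>
      joint_cdf H (\<chi> j. ereal (x $ j)) =
        (ln (joint_cdf G (\<chi> j. min (x $ j) 0)) - ln (joint_cdf G x)) / ln (joint_cdf G 0))"

end

theory Submission
  imports Defs
begin

text \<open>On the log scale every GEV margin factorises at the origin,
  $-\log G_j(x_j) = \tau_j (1 + \gamma_j x_j / \sigma_j)^{-1/\gamma_j}$, and \<open>l\<close> is homogeneous of
  degree one, so that dividing by \<open>- log G(0) = l \<tau>\<close> turns \<open>\<tau>\<close> into \<open>\<pi>\<close>.  The bounds on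
  \<open>\<pi>\<close> come from \<open>l \<tau> \<ge> \<tau>\<^sub>j\<close>.\<close>

text \<open>Multiplication by a nonnegative constant is monotone, so it commutes with the finite
  maximum, and the integral is linear.\<close>

lemma stdf_scale:
  fixes y :: "real ^ 'd"
  assumes l: "stdf l" and y: "\<forall>j. 0 \<le> y $ j" and c: "0 \<le> c"
  shows "l (\<chi> j. c * y $ j) = c * l y"
proof -
  obtain M :: "(real ^ 'd) measure"
    where M: "\<forall>y. (\<forall>j. 0 \<le> y $ j) \<longrightarrow> l y = (\<integral>v. (MAX j. y $ j * v $ j) \<partial>M)"
    using l unfolding stdf_def by blast
  have "(MAX j. c * y $ j * v $ j) = c * (MAX j. y $ j * v $ j)" for v :: "real ^ 'd"
  proof -
    have "mono ((*) c)"
      using c by (simp add: mono_def mult_left_mono)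
    from mono_Max_commute[OF this, of "range (\<lambda>j. y $ j * v $ j)"]
    show ?thesis by (simp add: image_image mult.assoc)
  qed
  then show ?thesis
    using M y c by simp
qed

text \<open>The maximum dominates its entry with index \<open>i\<close>, and that entry integrates
  to \<open>y $ i\<close> because the mean of \<open>v $ i\<close> is 1.\<close>

lemma stdf_ge_component:
  fixes y :: "real ^ 'd"
  assumes l: "stdf l" and y: "\<forall>j. 0 \<le> y $ j"
  shows "y $ i \<le> l y"
proof -
  obtain M :: "(real ^ 'd) measure"
    where sets: "sets M = sets borel"
      and nonneg: "AE v in M. \<forall>j. 0 \<le> v $ j"
      and int: "\<And>j. integrable M (\<lambda>v. v $ j)" and mean: "\<And>j. (\<integral>v. v $ j \<partial>M) = 1"
      and M: "\<forall>y. (\<forall>j. 0 \<le> y $ j) \<longrightarrow> l y = (\<integral>v. (MAX j. y $ j * v $ j) \<partial>M)"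
    using l unfolding stdf_def by blast
  have [measurable]: "(\<lambda>v. v $ j) \<in> borel_measurable M" for j
    using int by (rule borel_measurable_integrable)
  have comp_le: "y $ j * v $ j \<le> (MAX j. y $ j * v $ j)" for j and v :: "real ^ 'd"
    by (intro Max_ge) auto
  \<comment> \<open>The Bochner integral of a non-integrable function is 0 by default, so
    monotonicity of the integral has to be earned. Almost everywhere all entries are nonnegative,
    and then the maximum lies between 0 and the integrable sum of the entries.\<close>
  have "integrable M (\<lambda>v. MAX j. y $ j * v $ j)"
  proof (rule Bochner_Integration.integrable_bound)
    show "integrable M (\<lambda>v. \<Sum>j\<in>UNIV. y $ j * v $ j)"
      using int by (intro Bochner_Integration.integrable_sum integrable_mult_right)
    show "(\<lambda>v. MAX j. y $ j * v $ j) \<in> borel_measurable M"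
      by (rule borel_measurable_Max) auto
    show "AE v in M. norm (MAX j. y $ j * v $ j) \<le> norm (\<Sum>j\<in>UNIV. y $ j * v $ j)"
      using nonneg
    proof eventually_elim
      case (elim v)
      have "0 \<le> y $ i * v $ i"
        using elim y by simp
      then have "0 \<le> (MAX j. y $ j * v $ j)"
        using comp_le[of i v] by linarith
      moreover have "(MAX j. y $ j * v $ j) \<le> (\<Sum>j\<in>UNIV. y $ j * v $ j)"
        using elim y by (auto intro!: Max.boundedI member_le_sum)
      ultimately show ?case
        unfolding real_norm_def by linarith
    qed
  qed
  then have "(\<integral>v. y $ i * v $ i \<partial>M) \<le> (\<integral>v. (MAX j. y $ j * v $ j) \<partial>M)"
    using int comp_le by (intro integral_mono) auto
  then show ?thesis
    using M y mean by simp
qed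

lemma gp_pow_pos: "0 < 1 + \<gamma> * z \<Longrightarrow> 0 < gp_pow \<gamma> z"
  by (simp add: gp_pow_def)

text \<open>With \<open>\<sigma> = \<alpha> - \<gamma> * \<mu>\<close>, the base
  \<open>(\<alpha> + \<gamma> * (t - \<mu>)) / \<alpha>\<close> is the product of
  \<open>\<sigma> / \<alpha>\<close> and \<open>(\<sigma> + \<gamma> * t) / \<sigma>\<close>, and
  powers are multiplicative. For \<open>\<gamma> = 0\<close> the scale is
  \<open>\<sigma> = \<alpha>\<close>, and the exponents add.\<close>

lemma gp_pow_shift:
  assumes "0 < \<alpha>" and "0 < \<alpha> - \<gamma> * \<mu>" and "0 < \<alpha> - \<gamma> * \<mu> + \<gamma> * t"
  shows "gp_pow \<gamma> ((t - \<mu>) / \<alpha>) = gp_pow \<gamma> (- \<mu> / \<alpha>) * gp_pow \<gamma> (t / (\<alpha> - \<gamma> * \<mu>))"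
proof (cases "\<gamma> = 0")
  case True
  then show ?thesis
    by (simp add: gp_pow_def diff_divide_distrib flip: exp_add)
next
  case False
  have "0 \<le> 1 + \<gamma> * (- \<mu> / \<alpha>)" "0 \<le> 1 + \<gamma> * (t / (\<alpha> - \<gamma> * \<mu>))"
    using assms by (simp_all add: field_simps)
  moreover have "1 + \<gamma> * ((t - \<mu>) / \<alpha>) = (1 + \<gamma> * (- \<mu> / \<alpha>)) * (1 + \<gamma> * (t / (\<alpha> - \<gamma> * \<mu>)))"
    using assms by (simp add: divide_simps) (simp add: algebra_simps)
  ultimately show ?thesis
    using False by (simp add: gp_pow_def powr_mult)
qed

lemma gev_margin_eq_exp:
  assumes "0 < \<alpha>" and "0 < \<alpha> - \<gamma> * \<mu>" and "0 < \<alpha> - \<gamma> * \<mu> + \<gamma> * t"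
  shows "gev_margin \<mu> \<gamma> \<alpha> t = exp (- (gp_pow \<gamma> (- \<mu> / \<alpha>) * gp_pow \<gamma> (t / (\<alpha> - \<gamma> * \<mu>))))"
  using assms gp_pow_shift[OF assms] by (simp add: gev_margin_def algebra_simps)

lemma gp_pow_0 [simp]: "gp_pow \<gamma> 0 = 1"
  by (simp add: gp_pow_def)

text \<open>This supplies the side condition under which \<open>is_GP\<close> prescribes the cdf.
  Strictness holds because the condition on \<open>t\<close> is open: it survives at some
  \<open>s < t\<close>, where the margin is an exponential and hence positive.\<close>

lemma lower_endpoint_less:
  assumes F: "\<And>t. margin_cdf G j t = gev_margin \<mu> \<gamma> \<alpha> t" and t: "0 < \<alpha> + \<gamma> * (t - \<mu>)"
  shows "lower_endpoint G j < ereal t"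
proof -
  have "((\<lambda>s. \<alpha> + \<gamma> * (s - \<mu>)) \<longlongrightarrow> \<alpha> + \<gamma> * (t - \<mu>)) (at_left t)"
    by (intro tendsto_intros)
  then have "\<forall>\<^sub>F s in at_left t. 0 < \<alpha> + \<gamma> * (s - \<mu>)"
    using t by (rule order_tendstoD)
  moreover have "\<forall>\<^sub>F s in at_left t. s < t"
    by (simp add: eventually_at_filter)
  ultimately obtain s where s: "0 < \<alpha> + \<gamma> * (s - \<mu>)" "s < t"
    using eventually_happens'[OF trivial_limit_at_left_real eventually_conj] by blast
  then have "lower_endpoint G j \<le> ereal s"
    unfolding lower_endpoint_def by (intro Inf_lower) (auto simp: F gev_margin_def)
  then show ?thesis
    using s by (simp add: le_less_trans)
qed

theorem proposition3p1:
  fixes \<mu> \<gamma> \<alpha> \<sigma> \<tau> \<pi> :: "real ^ 'd"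
    and l :: "real ^ 'd \<Rightarrow> real"
    and G :: "(real ^ 'd) measure"
    and H :: "(ereal ^ 'd) measure"
  assumes alpha_pos: "\<forall>j. 0 < \<alpha> $ j"
    and stdf: "stdf l"
    and GEV: "is_GEV \<mu> \<gamma> \<alpha> l G"
    and sigma: "\<sigma> = (\<chi> j. \<alpha> $ j - \<gamma> $ j * \<mu> $ j)"
    and sigma_pos: "\<forall>j. 0 < \<sigma> $ j"
    and GP: "is_GP G H"
    and tau: "\<tau> = (\<chi> j. - ln (margin_cdf G j 0))"
    and pi: "\<pi> = (\<chi> j. \<tau> $ j / l \<tau>)"
  shows "(\<forall>x :: real ^ 'd. (\<forall>j. \<sigma> $ j + \<gamma> $ j * x $ j > 0) \<longrightarrow>
            joint_cdf H (\<chi> j. ereal (x $ j)) =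
              l (\<chi> j. \<pi> $ j * gp_pow (\<gamma> $ j) (min (x $ j) 0 / \<sigma> $ j))
              - l (\<chi> j. \<pi> $ j * gp_pow (\<gamma> $ j) (x $ j / \<sigma> $ j)))
       \<and> (\<forall>j. \<tau> $ j = gp_pow (\<gamma> $ j) (- \<mu> $ j / \<alpha> $ j) \<and> 0 < \<tau> $ j)
       \<and> l \<tau> = - ln (joint_cdf G 0)
       \<and> (\<forall>j. 0 < \<pi> $ j \<and> \<pi> $ j \<le> 1)"
proof -
  \<comment> \<open>\<open>e x\<close> is what remains of the negative log margins at
    \<open>x\<close> once the factor \<open>\<tau>\<close> is split off; \<open>e 0\<close> is the
    vector of ones.\<close>
  define e where "e = (\<lambda>x :: real ^ 'd. \<chi> j. gp_pow (\<gamma> $ j) (x $ j / \<sigma> $ j))"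
  have F: "margin_cdf G j t = gev_margin (\<mu> $ j) (\<gamma> $ j) (\<alpha> $ j) t" for j t
    using GEV unfolding is_GEV_def by blast
  have margin: "margin_cdf G j t =
      exp (- (gp_pow (\<gamma> $ j) (- \<mu> $ j / \<alpha> $ j) * gp_pow (\<gamma> $ j) (t / \<sigma> $ j)))"
    if "0 < \<sigma> $ j + \<gamma> $ j * t" for j t
    using that alpha_pos sigma_pos by (simp add: F sigma gev_margin_eq_exp)
  have tau_eq: "\<tau> $ j = gp_pow (\<gamma> $ j) (- \<mu> $ j / \<alpha> $ j)" for j
    using sigma_pos by (simp add: tau margin)
  \<comment> \<open>The base of the power is \<open>\<sigma> $ j / \<alpha> $ j\<close>.\<close>
  have tau_pos: "0 < \<tau> $ j" for j
    using sigma_pos alpha_pos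
    by (simp add: tau_eq sigma gp_pow_pos field_simps)
  have cdf_G: "joint_cdf G x = exp (- l (\<chi> j. \<tau> $ j * e x $ j))"
    if "\<forall>j. 0 < \<sigma> $ j + \<gamma> $ j * x $ j" for x
  proof -
    have "\<forall>j. 0 < margin_cdf G j (x $ j)"
      using that by (simp add: margin)
    then have "joint_cdf G x = exp (- l (\<chi> j. - ln (margin_cdf G j (x $ j))))"
      using GEV unfolding is_GEV_def by blast
    then show ?thesis
      using that by (simp add: margin tau_eq e_def)
  qed
  have cdf_G_0: "joint_cdf G 0 = exp (- l \<tau>)"
    using sigma_pos by (simp add: cdf_G e_def)
  have tau_le: "\<tau> $ j \<le> l \<tau>" for j
    using stdf_ge_component[OF stdf] tau_pos less_imp_le by blast
  have l_tau_pos: "0 < l \<tau>"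
    using tau_pos tau_le less_le_trans by blast
  \<comment> \<open>Homogeneity with the factor \<open>1 / l \<tau>\<close>, which turns
    \<open>\<tau>\<close> into \<open>\<pi>\<close>; it needs a nonnegative argument, hence the sign
    of \<open>e x\<close>.\<close>
  have l_pi: "l (\<chi> j. \<pi> $ j * e x $ j) = l (\<chi> j. \<tau> $ j * e x $ j) / l \<tau>"
    if "\<forall>j. 0 < \<sigma> $ j + \<gamma> $ j * x $ j" for x
  proof -
    have "0 \<le> e x $ j" for j
    proof -
      have "0 < 1 + \<gamma> $ j * (x $ j / \<sigma> $ j)"
        using that[rule_format, of j] sigma_pos[rule_format, of j]
        by (simp add: field_simps)
      then show ?thesis
        by (simp add: e_def gp_pow_pos less_imp_le)
    qed
    then have "\<forall>j. 0 \<le> (\<chi> j. \<tau> $ j * e x $ j) $ j"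
      using tau_pos by (simp add: less_imp_le)
    from stdf_scale[OF stdf this, of "1 / l \<tau>"] show ?thesis
      using l_tau_pos by (simp add: pi)
  qed
  have "joint_cdf H (\<chi> j. ereal (x $ j)) =
      l (\<chi> j. \<pi> $ j * gp_pow (\<gamma> $ j) (min (x $ j) 0 / \<sigma> $ j))
      - l (\<chi> j. \<pi> $ j * gp_pow (\<gamma> $ j) (x $ j / \<sigma> $ j))"
    if x: "\<forall>j. \<sigma> $ j + \<gamma> $ j * x $ j > 0" for x :: "real ^ 'd"
  proof -
    define m where "m = (\<chi> j. min (x $ j) 0)"
    \<comment> \<open>Each component of \<open>m\<close> is either that of \<open>x\<close> or 0,
      and at 0 the condition is \<open>sigma_pos\<close>.\<close>
    have m: "\<forall>j. 0 < \<sigma> $ j + \<gamma> $ j * m $ j"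
      using x sigma_pos by (simp add: m_def min_def)
    have "lower_endpoint G j < ereal (x $ j)" for j
    proof -
      have "0 < \<alpha> $ j + \<gamma> $ j * (x $ j - \<mu> $ j)"
        using x by (simp add: sigma algebra_simps)
      with F show ?thesis by (rule lower_endpoint_less)
    qed
    then have "joint_cdf H (\<chi> j. ereal (x $ j)) =
        (ln (joint_cdf G m) - ln (joint_cdf G x)) / ln (joint_cdf G 0)"
      using GP unfolding is_GP_def m_def by blast
    \<comment> \<open>Each logarithm is minus a value of \<open>l\<close>; the sign of the
      denominator \<open>- l \<tau>\<close> reverses the order of the difference, and
      \<open>l_pi\<close> absorbs the division.\<close>
    also have "\<dots> = l (\<chi> j. \<pi> $ j * e m $ j) - l (\<chi> j. \<pi> $ j * e x $ j)"
      using l_tau_pos by (simp add: cdf_G[OF m] cdf_G[OF x] cdf_G_0 l_pi[OF m] l_pi[OF x] field_simps)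
    finally show ?thesis
      by (simp add: e_def m_def)
  qed
  moreover have "0 < \<pi> $ j \<and> \<pi> $ j \<le> 1" for j
    using tau_pos[of j] tau_le[of j] l_tau_pos by (simp add: pi)
  ultimately show ?thesis
    using tau_eq tau_pos cdf_G_0 by simp
qed

end
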